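(* Let $k_1,k_2\ge1$ be integers. For all $n\ge k_1+k_2$, $$P_{q,\theta}\big(L_n^{(1)}\ge k_1,\ L_n^{(0)}\ge k_2\big)=\sum_{i=k_2}^{n-k_1}\theta^{n-i}\prod_{j=1}^{i}(1-\theta q^{j-1})\sum_{s=1}^{i}\Big[Q_{q,k_1,k_2}(n-i,i,s)+R_{q,k_1,k_2}(n-i,i,s)+S_{q,k_1,k_2}(n-i,i,s+1)+T_{q,k_1,k_2}(n-i,i,s)\Big].$$
   Context: Model: fix reals $0\le\theta\le1$ and $0<q<1$. $(X_j)_{j\ge1}$ is a sequence of $\{0,1\}$-valued random variables (1 = success, 0 = failure) with law $P_{q,\theta}$ such that, conditionally on $X_1,\dots,X_{j-1}$ containing exactly $i-1$ zeros, $X_j=0$ with probability $1-\theta q^{i-1}$ and $X_j=1$ with probability $\theta q^{i-1}$. Conventions: $0^0=1$, empty products are 1, empty sums are 0. $L_n^{(1)}$ and $L_n^{(0)}$ are the lengths of the longest run of consecutive successes and of consecutive failures, respectively, in $X_1,\dots,X_n$ ($0$ if there is none). $S_{r,s}^{k}$ denotes the set of $s$-tuples of positive integers with sum $r$ and maximum $>k$ (for $k=0$ the maximum condition is vacuous). Combinatorial sums, for integers $m,r$ and $s\ge1$: - $Q_{q,k_1,k_2}(m,r,s)=\sum q^{\sum_{j=1}^{s}(y_1+\dots+y_j)x_j}$ over $(x_1,\dots,x_s)\in S_{m,s}^{k_1-1}$, $(y_1,\dots,y_s)\in S_{r,s}^{k_2-1}$; - $R_{q,k_1,k_2}(m,r,s)=\sum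 q^{\sum_{j=1}^{s-1}(y_1+\dots+y_j)x_j}$ over $(x_1,\dots,x_{s-1})\in S_{m,s-1}^{k_1-1}$, $(y_1,\dots,y_s)\in S_{r,s}^{k_2-1}$ (for $s=1$ and $m\ge1$ this is $0$, there being no $0$-tuple with sum $m\geq 1$); - $S_{q,k_1,k_2}(m,r,s)=\sum q^{\sum_{j=2}^{s}(y_1+\dots+y_{j-1})x_j}$ over $(x_1,\dots,x_s)\in S_{m,s}^{k_1-1}$, $(y_1,\dots,y_{s-1})\in S_{r,s-1}^{k_2-1}$; - $T_{q,k_1,k_2}(m,r,s)=\sum q^{\sum_{j=2}^{s}(y_1+\dots+y_{j-1})x_j}$ over $(x_1,\dots,x_s)\in S_{m,s}^{k_1-1}$, $(y_1,\dots,y_s)\in S_{r,s}^{k_2-1}$. *)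

theory Defs
  imports "HOL-Probability.Probability"
begin

text \<open>Only the variables \<open>X j\<close> with \<open>j \<ge> 1\<close> are constrained; \<open>X 0\<close> plays no role.
  The conditioning is on the full past \<open>X 1, \<dots>, X (j - 1)\<close>: for every past \<open>x 1, \<dots>, x (j - 1)\<close> of
  positive probability, the conditional law of \<open>X j\<close> depends on it only through its number \<open>i - 1\<close>
  of zeros.\<close>

locale q_bernoulli_process = prob_space M for M :: "'a measure" +
  fixes X :: "nat \<Rightarrow> 'a \<Rightarrow> nat" and q \<theta> :: real
  assumes binary: "\<And>j. 1 \<le> j \<Longrightarrow> random_variable (count_space {0, 1}) (X j)"
    and failure_prob:
      "\<And>j i x. \<lbrakk>1 \<le> j; 1 \<le> i; card {l \<in> {1..<j}. x l = 0} = i - 1;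
          \<P>(\<omega> in M. \<forall>l\<in>{1..<j}. X l \<omega> = x l) > 0\<rbrakk>
        \<Longrightarrow> \<P>(\<omega> in M. X j \<omega> = 0 \<bar> \<forall>l\<in>{1..<j}. X l \<omega> = x l) = 1 - \<theta> * q ^ (i - 1)"
    and success_prob:
      "\<And>j i x. \<lbrakk>1 \<le> j; 1 \<le> i; card {l \<in> {1..<j}. x l = 0} = i - 1;
          \<P>(\<omega> in M. \<forall>l\<in>{1..<j}. X l \<omega> = x l) > 0\<rbrakk>
        \<Longrightarrow> \<P>(\<omega> in M. X j \<omega> = 1 \<bar> \<forall>l\<in>{1..<j}. X l \<omega> = x l) = \<theta> * q ^ (i - 1)"

text \<open>Length of the longest block of consecutive indices in \<open>{1..n}\<close> on which \<open>x\<close> equals \<open>v\<close>;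
  the empty block \<open>l = 0\<close> always qualifies.\<close>

definition longest_run :: "nat \<Rightarrow> (nat \<Rightarrow> nat) \<Rightarrow> nat \<Rightarrow> nat" where
  "longest_run v x n = Max {l. \<exists>a. a + l \<le> n \<and> (\<forall>j\<in>{a+1..a+l}. x j = v)}"

definition longest_success_run :: "(nat \<Rightarrow> 'a \<Rightarrow> nat) \<Rightarrow> nat \<Rightarrow> 'a \<Rightarrow> nat" where
  "longest_success_run X n \<omega> = longest_run 1 (\<lambda>j. X j \<omega>) n"

definition longest_failure_run :: "(nat \<Rightarrow> 'a \<Rightarrow> nat) \<Rightarrow> nat \<Rightarrow> 'a \<Rightarrow> nat" where
  "longest_failure_run X n \<omega> = longest_run 0 (\<lambda>j. X j \<omega>) n"

text \<open>The set $S_{r,s}^{k}$. Tuples are lists, so the \<open>j\<close>-th entry (counted from 1) of \<open>xs\<close> is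
  \<open>xs ! (j - 1)\<close>, and \<open>sum_list (take j ys)\<close> is the sum of the first \<open>j\<close> entries of \<open>ys\<close>.\<close>

definition comps :: "nat \<Rightarrow> nat \<Rightarrow> nat \<Rightarrow> nat list set" where
  "comps k r s = {xs. length xs = s \<and> (\<forall>x\<in>set xs. 0 < x) \<and> sum_list xs = r \<and>
                      (k = 0 \<or> xs \<noteq> [] \<and> Max (set xs) > k)}"

lemma finite_comps: "finite (comps k r s)"
proof (rule finite_subset)
  show "comps k r s \<subseteq> {xs. set xs \<subseteq> {..r} \<and> length xs = s}"
    by (auto simp: comps_def member_le_sum_list)
  show "finite {xs. set xs \<subseteq> {..r} \<and> length xs = s}"
    by (rule finite_lists_length_eq) simp
qed

definition Q_sum :: "real \<Rightarrow> nat \<Rightarrow> nat \<Rightarrow> nat \<Rightarrow> nat \<Rightarrow> nat \<Rightarrow> real" where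
  "Q_sum q k1 k2 m r s = (\<Sum>xs\<in>comps (k1 - 1) m s. \<Sum>ys\<in>comps (k2 - 1) r s.
     q ^ (\<Sum>j=1..s. sum_list (take j ys) * xs ! (j - 1)))"

definition R_sum :: "real \<Rightarrow> nat \<Rightarrow> nat \<Rightarrow> nat \<Rightarrow> nat \<Rightarrow> nat \<Rightarrow> real" where
  "R_sum q k1 k2 m r s = (\<Sum>xs\<in>comps (k1 - 1) m (s - 1). \<Sum>ys\<in>comps (k2 - 1) r s.
     q ^ (\<Sum>j=1..s - 1. sum_list (take j ys) * xs ! (j - 1)))"

definition S_sum :: "real \<Rightarrow> nat \<Rightarrow> nat \<Rightarrow> nat \<Rightarrow> nat \<Rightarrow> nat \<Rightarrow> real" where
  "S_sum q k1 k2 m r s = (\<Sum>xs\<in>comps (k1 - 1) m s. \<Sum>ys\<in>comps (k2 - 1) r (s - 1).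
     q ^ (\<Sum>j=2..s. sum_list (take (j - 1) ys) * xs ! (j - 1)))"

definition T_sum :: "real \<Rightarrow> nat \<Rightarrow> nat \<Rightarrow> nat \<Rightarrow> nat \<Rightarrow> nat \<Rightarrow> real" where
  "T_sum q k1 k2 m r s = (\<Sum>xs\<in>comps (k1 - 1) m s. \<Sum>ys\<in>comps (k2 - 1) r s.
     q ^ (\<Sum>j=2..s. sum_list (take (j - 1) ys) * xs ! (j - 1)))"

end

theory Submission
  imports Defs "HOL-Library.Sublist"
begin

text \<open>
  A word over \<open>{0, 1}\<close> splits uniquely into maximal constant blocks, and these alternate between the
  two letters. So a nonempty word is the same thing as its first letter together with the list
  \<open>xs\<close> of lengths of its blocks of successes and the list \<open>ys\<close> of lengths of its blocks of failures
  (\<open>weave_inject\<close>, \<open>weave_surj\<close>). Because blocks are maximal, a run of \<open>k \<ge> 1\<close> equal letters is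
  present exactly when some block of that letter has length at least \<open>k\<close> (\<open>run_weave\<close>): the two run
  conditions become conditions on the maxima of \<open>xs\<close> and of \<open>ys\<close> separately.

  The probability of a word depends on it only through three numbers. Each success contributes
  \<open>\<theta> q ^ z\<close>, where \<open>z\<close> is the number of failures before it, and the \<open>j\<close>-th failure contributes
  \<open>1 - \<theta> q ^ (j - 1)\<close>. Hence the probability is a power of \<open>\<theta>\<close> given by the number of successes,
  times a product given by the number of failures, times \<open>q\<close> to the number of pairs consisting of a
  failure and a later success (\<open>prob_word\<close>). This number of pairs, computed block by block, is
  exactly the exponent in the four combinatorial sums (\<open>noninversions_weave\<close>).

  The event is therefore a sum over words; grouping the words by their number \<open>i\<close> of failures pulls
  the power of \<open>\<theta>\<close> and the product out of the sum. What is left is split by the first letter and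
  by whether the two letters have equally many blocks, that is, whether the last letter differs
  from the first. The words \<open>0\<dots>1\<close>, \<open>0\<dots>0\<close>, \<open>1\<dots>1\<close>, \<open>1\<dots>0\<close> give the sums
  \<open>Q\<close>, \<open>R\<close>, \<open>S\<close>, \<open>T\<close> respectively, and \<open>s\<close> is the number of blocks of failures
  (\<open>sum_words_with_runs\<close>).
\<close>

section \<open>Words woven from two lists of block lengths\<close>

text \<open>The word with alternating blocks of \<open>a\<close> and \<open>b\<close>, starting with \<open>a\<close>, where \<open>xs\<close> lists the
  lengths of the blocks of \<open>a\<close> and \<open>ys\<close> those of \<open>b\<close>. After each block the roles of the two letters
  are exchanged, which lets one recursion cover both possible first letters.\<close>

function weave :: "'b \<Rightarrow> 'b \<Rightarrow> nat list \<Rightarrow> nat list \<Rightarrow> 'b list" where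
  "weave a b [] ys = []"
| "weave a b (x # xs) ys = replicate x a @ weave b a ys xs"
  by pat_completeness auto
termination by (relation "Wellfounded.measure (\<lambda>(a, b, xs, ys). length xs + length ys)") auto

text \<open>The pairs of length lists that the block decomposition of a word starting with \<open>a\<close> can produce:
  as blocks alternate, \<open>a\<close> has as many blocks as \<open>b\<close>, or one more. In particular
  the empty list \<open>xs\<close> only occurs for the empty word.\<close>

definition balanced :: "nat list \<Rightarrow> nat list \<Rightarrow> bool" where
  "balanced xs ys \<longleftrightarrow> 0 \<notin> set xs \<and> 0 \<notin> set ys \<and>
     (length xs = length ys \<or> length xs = Suc (length ys))"

lemma balanced_Nil [simp]: "balanced [] ys \<longleftrightarrow> ys = []"
  by (auto simp: balanced_def)

lemma balanced_Cons [simp]: "balanced (x # xs) ys \<longleftrightarrow> 0 < x \<and> balanced ys xs"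
  by (auto simp: balanced_def)

lemma hd_weave:
  "balanced xs ys \<Longrightarrow> xs \<noteq> [] \<Longrightarrow> weave a b xs ys \<noteq> [] \<and> hd (weave a b xs ys) = a"
  by (cases xs) (auto simp: hd_append)

lemma weave_eq_Nil: "balanced xs ys \<Longrightarrow> weave a b xs ys = [] \<longleftrightarrow> xs = []"
  by (cases xs) auto

lemma replicate_append_inject:
  assumes "replicate m a @ u = replicate n a @ v"
    and "u = [] \<or> hd u \<noteq> a" and "v = [] \<or> hd v \<noteq> a"
  shows "m = n \<and> u = v"
  using assms
proof (induction m arbitrary: n)
  case 0
  then show ?case by (cases n) auto
next
  case (Suc m)
  then show ?case by (cases n) auto
qed

lemma weave_not_hd:
  "balanced xs ys \<Longrightarrow> a \<noteq> b \<Longrightarrow> weave b a xs ys = [] \<or> hd (weave b a xs ys) \<noteq> a"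
  using hd_weave[of xs ys b a] by (cases xs) auto

text \<open>The word following the first block does not start with \<open>a\<close>, so the first block is recovered
  as the longest prefix of letters \<open>a\<close>, and the rest by induction.\<close>

lemma weave_inject:
  assumes "a \<noteq> b" "balanced xs ys" "balanced xs' ys'"
    and "weave a b xs ys = weave a b xs' ys'"
  shows "xs = xs' \<and> ys = ys'"
  using assms
proof (induction a b xs ys arbitrary: xs' ys' rule: weave.induct)
  case (1 a b ys)
  then show ?case using weave_eq_Nil[of xs' ys' a b] by auto
next
  case (2 a b x xs ys)
  then obtain x' zs where xs': "xs' = x' # zs"
    by (cases xs') auto
  have "x = x' \<and> weave b a ys xs = weave b a ys' zs"
    by (rule replicate_append_inject[of _ a])
      (use 2 xs' weave_not_hd[of ys xs a b] weave_not_hd[of ys' zs a b] in auto)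
  with 2 xs' show ?case by auto
qed

text \<open>A letter put in front of a word either lengthens the first block or forms a new block of
  length 1.\<close>

lemma weave_surj:
  assumes "set w \<subseteq> {a, b}"
  shows "\<exists>xs ys. balanced xs ys \<and> (w = weave a b xs ys \<or> w = weave b a xs ys)"
  using assms
proof (induction w)
  case Nil
  show ?case by (rule exI[of _ "[]"]) auto
next
  case (Cons c w)
  have step: "\<exists>xs ys. balanced xs ys \<and> c # w = weave c d xs ys"
    if bal: "balanced us vs" and "w = weave c d us vs \<or> w = weave d c us vs" for us vs d
    using that(2)
  proof
    assume w: "w = weave c d us vs"
    show ?thesis
    proof (cases us)
      case Nil
      with bal w show ?thesis by (intro exI[of _ "[1]"] exI[of _ "[]"]) auto
    next
      case (Cons u us')
      with bal w show ?thesis by (intro exI[of _ "Suc u # us'"] exI[of _ vs]) auto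
    qed
  next
    assume "w = weave d c us vs"
    with bal show ?thesis by (intro exI[of _ "1 # vs"] exI[of _ us]) auto
  qed
  from Cons obtain us vs
    where "balanced us vs" "w = weave a b us vs \<or> w = weave b a us vs" by auto
  moreover from Cons have "c = a \<or> c = b" by auto
  ultimately show ?case using step[of us vs a] step[of us vs b] by blast
qed

lemma count_list_replicate: "count_list (replicate n x) y = (if x = y then n else 0)"
  by (induction n) auto

lemma count_weave:
  assumes "a \<noteq> b" "balanced xs ys"
  shows "count_list (weave a b xs ys) a = sum_list xs"
    and "count_list (weave a b xs ys) b = sum_list ys"
  using assms
  by (induction a b xs ys rule: weave.induct) (auto simp: count_list_replicate)

lemma set_weave: "set (weave a b xs ys) \<subseteq> {a, b}"
  by (induction a b xs ys rule: weave.induct) auto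

lemma count_binary:
  "set w \<subseteq> {a, b} \<Longrightarrow> a \<noteq> b \<Longrightarrow> count_list w a + count_list w b = length w"
  by (induction w) auto

section \<open>Runs in a word\<close>

lemma prefix_replicate_append:
  assumes "w = [] \<or> hd w \<noteq> a"
  shows "prefix (replicate k a) (replicate x a @ w) \<longleftrightarrow> k \<le> x"
proof (induction k arbitrary: x)
  case 0
  then show ?case by simp
next
  case (Suc k)
  show ?case
  proof (cases x)
    case 0
    with assms show ?thesis by (cases w) auto
  next
    case (Suc y)
    with Suc.IH show ?thesis by simp
  qed
qed

text \<open>If \<open>w\<close> does not continue the block in front of it, a run of letters \<open>a\<close> cannot straddle the
  boundary: it lies in the block or in \<open>w\<close>.\<close>

lemma run_in_own_block:
  assumes "w = [] \<or> hd w \<noteq> a"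
  shows "sublist (replicate k a) (replicate x a @ w) \<longleftrightarrow> k \<le> x \<or> sublist (replicate k a) w"
proof (induction x)
  case 0
  then show ?case by (cases k) auto
next
  case (Suc x)
  have "sublist (replicate k a) (replicate (Suc x) a @ w) \<longleftrightarrow>
      prefix (replicate k a) (replicate (Suc x) a @ w) \<or> sublist (replicate k a) (replicate x a @ w)"
    by (simp add: sublist_Cons_right)
  with Suc show ?case
    unfolding prefix_replicate_append[OF assms] by auto
qed

lemma run_in_other_block:
  assumes "0 < k" "c \<noteq> a"
  shows "sublist (replicate k c) (replicate x a @ w) \<longleftrightarrow> sublist (replicate k c) w"
  using assms by (induction x) (auto simp: sublist_Cons_right gr0_conv_Suc)

lemma run_weave:
  assumes "a \<noteq> b" "balanced xs ys" "0 < k"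
  shows "sublist (replicate k a) (weave a b xs ys) \<longleftrightarrow> (\<exists>x\<in>set xs. k \<le> x)"
    and "sublist (replicate k b) (weave a b xs ys) \<longleftrightarrow> (\<exists>y\<in>set ys. k \<le> y)"
  using assms
proof (induction a b xs ys rule: weave.induct)
  case (2 a b x xs ys)
  { case 1
    with 2 show ?case
      using run_in_own_block[OF weave_not_hd[of ys xs a b], of k x] by auto
  next
    case 2
    with "2.IH" show ?case by (auto simp: run_in_other_block) }
qed auto

text \<open>A run of length \<open>l \<ge> k\<close> contains one of length exactly \<open>k\<close>, so the maximum in the definition
  of the longest run reduces to the occurrence of one constant factor.\<close>

lemma le_longest_run_iff:
  "k \<le> longest_run v x n \<longleftrightarrow> sublist (replicate k v) (map x [1..<Suc n])"
proof -
  define L where "L = {l. \<exists>a. a + l \<le> n \<and> (\<forall>j\<in>{a+1..a+l}. x j = v)}"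
  have "L \<subseteq> {..n}" "0 \<in> L" by (auto simp: L_def)
  then have "finite L" "L \<noteq> {}" by (auto intro: finite_subset)
  then have "k \<le> longest_run v x n \<longleftrightarrow> (\<exists>l\<in>L. k \<le> l)"
    by (simp add: longest_run_def L_def Max_ge_iff)
  also have "\<dots> \<longleftrightarrow> (\<exists>a. a + k \<le> n \<and> (\<forall>j\<in>{a+1..a+k}. x j = v))"
  proof
    assume "\<exists>l\<in>L. k \<le> l"
    then obtain l a where "k \<le> l" "a + l \<le> n" "\<forall>j\<in>{a+1..a+l}. x j = v"
      by (auto simp: L_def)
    then show "\<exists>a. a + k \<le> n \<and> (\<forall>j\<in>{a+1..a+k}. x j = v)"
      by (intro exI[of _ a]) auto
  qed (auto simp: L_def)
  also have "\<dots> \<longleftrightarrow> sublist (replicate k v) (map x [1..<Suc n])"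
  proof
    assume "\<exists>a. a + k \<le> n \<and> (\<forall>j\<in>{a+1..a+k}. x j = v)"
    then obtain a where a: "a + k \<le> n" "\<forall>j\<in>{a+1..a+k}. x j = v" by blast
    then have "replicate k v = take k (drop a (map x [1..<Suc n]))"
      by (intro nth_equalityI) (auto simp del: upt_Suc)
    then show "sublist (replicate k v) (map x [1..<Suc n])"
      using sublist_order.order.trans[OF sublist_take sublist_drop] by metis
  next
    assume "sublist (replicate k v) (map x [1..<Suc n])"
    then obtain us vs where w: "map x [1..<Suc n] = us @ replicate k v @ vs"
      by (auto simp: sublist_def)
    let ?a = "length us"
    from arg_cong[OF w, of length] have "?a + k \<le> n" by (simp del: upt_Suc)
    moreover have "x j = v" if "j \<in> {?a+1..?a+k}" for j
    proof -
      from that \<open>?a + k \<le> n\<close> have "x j = map x [1..<Suc n] ! (j - 1)"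
        by (auto simp del: upt_Suc)
      also have "\<dots> = v" using that unfolding w by (auto simp: nth_append)
      finally show ?thesis .
    qed
    ultimately show "\<exists>a. a + k \<le> n \<and> (\<forall>j\<in>{a+1..a+k}. x j = v)" by blast
  qed
  finally show ?thesis .
qed

section \<open>The probability of a word\<close>

text \<open>For a word over \<open>{0, 1}\<close> this counts the pairs of positions at which a 0 precedes a 1, adjacent
  or not.\<close>

fun noninversions :: "nat list \<Rightarrow> nat" where
  "noninversions [] = 0"
| "noninversions (c # w) = (if c = 0 then count_list w 1 else 0) + noninversions w"

lemma noninversions_append:
  "noninversions (u @ v) = noninversions u + noninversions v + count_list u 0 * count_list v 1"
  by (induction u) (auto simp: algebra_simps)

lemma noninversions_replicate [simp]: "noninversions (replicate x c) = 0"
  by (induction x) (auto simp: count_list_replicate)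

text \<open>All letters 1 in one block have the same zeros before them, so the \<open>j\<close>-th block of letters 1
  contributes its length times the total length of the earlier blocks of 0: there are
  \<open>j - 1\<close> of these if the word starts with 1, and \<open>j\<close> if it starts with 0. The two formulas are proved
  together, since removing the first block turns one into the other.\<close>

lemma noninversions_weave:
  assumes "balanced xs ys"
  shows "noninversions (weave 1 0 xs ys) = (\<Sum>j=1..length xs. sum_list (take (j - 1) ys) * xs ! (j - 1))"
    and "noninversions (weave 0 1 xs ys) = (\<Sum>j=1..length ys. sum_list (take j xs) * ys ! (j - 1))"
  using assms
proof (induction "length xs + length ys" arbitrary: xs ys rule: less_induct)
  case less
  { case 1
    show ?case
    proof (cases xs)
      case (Cons x zs)
      have "noninversions (weave 1 0 xs ys) = noninversions (weave 0 1 ys zs)"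
        using Cons by (simp add: noninversions_append count_list_replicate)
      also have "\<dots> = (\<Sum>j=1..length zs. sum_list (take j ys) * zs ! (j - 1))"
        using less 1 Cons by auto
      also have "\<dots> = (\<Sum>j=1..length xs. sum_list (take (j - 1) ys) * xs ! (j - 1))"
        unfolding Cons One_nat_def sum.atLeast1_atMost_eq
        by (simp add: sum.lessThan_Suc_shift del: sum.lessThan_Suc)
      finally show ?thesis .
    qed (use 1 in auto)
  next
    case 2
    show ?case
    proof (cases xs)
      case (Cons x zs)
      \<comment> \<open>Each of the \<open>x\<close> leading zeros precedes every 1 of the word.\<close>
      have "noninversions (weave 0 1 xs ys) = x * sum_list ys + noninversions (weave 1 0 ys zs)"
        using Cons 2 count_weave(1)[of "1::nat" 0 ys zs]
        by (simp add: noninversions_append count_list_replicate)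
      also have "noninversions (weave 1 0 ys zs)
          = (\<Sum>j=1..length ys. sum_list (take (j - 1) zs) * ys ! (j - 1))"
        using less 2 Cons by auto
      also have "x * sum_list ys = (\<Sum>j=1..length ys. x * ys ! (j - 1))"
        by (simp add: sum_list_sum_nth sum.atLeast1_atMost_eq sum_distrib_left atLeast0LessThan)
      also have "\<dots> + (\<Sum>j=1..length ys. sum_list (take (j - 1) zs) * ys ! (j - 1))
          = (\<Sum>j=1..length ys. sum_list (take j xs) * ys ! (j - 1))"
        unfolding sum.distrib[symmetric]
        by (intro sum.cong) (auto simp: Cons take_Cons' algebra_simps)
      finally show ?thesis .
    qed (use 2 in auto) }
qed

definition word_weight :: "real \<Rightarrow> real \<Rightarrow> nat list \<Rightarrow> real" where
  "word_weight q \<theta> w =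
     \<theta> ^ count_list w 1 * (\<Prod>j=1..count_list w 0. 1 - \<theta> * q ^ (j - 1)) * q ^ noninversions w"

lemma word_weight_snoc:
  "word_weight q \<theta> (w @ [0]) = word_weight q \<theta> w * (1 - \<theta> * q ^ count_list w 0)"
  "word_weight q \<theta> (w @ [1]) = word_weight q \<theta> w * (\<theta> * q ^ count_list w 0)"
  by (simp_all add: word_weight_def noninversions_append power_add)

context q_bernoulli_process
begin

definition word :: "nat \<Rightarrow> 'a \<Rightarrow> nat list" where
  "word n \<omega> = map (\<lambda>l. X l \<omega>) [1..<Suc n]"

lemma word_Suc: "word (Suc n) \<omega> = word n \<omega> @ [X (Suc n) \<omega>]"
  by (simp add: word_def)

lemma length_word [simp]: "length (word n \<omega>) = n"
  by (simp add: word_def)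

lemma X_binary: "1 \<le> j \<Longrightarrow> \<omega> \<in> space M \<Longrightarrow> X j \<omega> \<in> {0, 1}"
  using measurable_space[OF binary[of j]] by simp

lemma set_word: "\<omega> \<in> space M \<Longrightarrow> set (word n \<omega>) \<subseteq> {0, 1}"
  using X_binary by (fastforce simp: word_def)

lemma X_event:
  assumes "1 \<le> j"
  shows "{\<omega> \<in> space M. X j \<omega> = c} \<in> events"
proof -
  have "X j -` ({c} \<inter> {0, 1}) \<inter> space M \<in> events"
    by (rule measurable_sets[OF binary[OF assms]]) auto
  also have "X j -` ({c} \<inter> {0, 1}) \<inter> space M = {\<omega> \<in> space M. X j \<omega> = c}"
    using X_binary[OF assms] by auto
  finally show ?thesis .
qed

lemma word_event: "{\<omega> \<in> space M. word n \<omega> = w} \<in> events"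
proof (induction n arbitrary: w)
  case 0
  then show ?case by (simp add: word_def)
next
  case (Suc n)
  show ?case
  proof (cases w rule: rev_cases)
    case Nil
    then show ?thesis by (simp add: word_Suc)
  next
    case (snoc u c)
    then have "{\<omega> \<in> space M. word (Suc n) \<omega> = w}
        = {\<omega> \<in> space M. word n \<omega> = u} \<inter> {\<omega> \<in> space M. X (Suc n) \<omega> = c}"
      by (auto simp: word_Suc)
    with Suc X_event[of "Suc n"] show ?thesis by auto
  qed
qed

lemma word_eq_iff:
  assumes "length w = n"
  shows "word n \<omega> = w \<longleftrightarrow> (\<forall>l\<in>{1..<Suc n}. X l \<omega> = w ! (l - 1))"
proof
  assume "word n \<omega> = w"
  then show "\<forall>l\<in>{1..<Suc n}. X l \<omega> = w ! (l - 1)"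
    by (auto simp: word_def simp del: upt_Suc)
next
  assume *: "\<forall>l\<in>{1..<Suc n}. X l \<omega> = w ! (l - 1)"
  show "word n \<omega> = w"
  proof (rule nth_equalityI)
    fix i assume "i < length (word n \<omega>)"
    with *[rule_format, of "Suc i"] show "word n \<omega> ! i = w ! i"
      by (simp add: word_def del: upt_Suc)
  qed (simp add: assms)
qed

text \<open>The law of the process counts the zeros of the past by their positions, which start at 1; the
  weight of a word counts them as letters.\<close>

lemma card_letter_positions:
  "card {l \<in> {1..<Suc (length w)}. w ! (l - 1) = c} = count_list w c"
proof -
  have "{l \<in> {1..<Suc (length w)}. w ! (l - 1) = c} = Suc ` {i. i < length w \<and> c = w ! i}"
  proof (intro equalityI subsetI)
    fix l assume "l \<in> {l \<in> {1..<Suc (length w)}. w ! (l - 1) = c}"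
    then show "l \<in> Suc ` {i. i < length w \<and> c = w ! i}"
      by (intro image_eqI[of _ _ "l - 1"]) auto
  qed auto
  then show ?thesis
    by (simp add: card_image count_list_eq_length_filter length_filter_conv_card)
qed

text \<open>The chain rule, by induction on the length of the word. If the past has probability zero, the
  transition law says nothing; but then the extended word has probability zero as well, and its
  weight vanishes because it has the weight of the past as a factor.\<close>

lemma prob_word:
  assumes "set w \<subseteq> {0, 1}"
  shows "\<P>(\<omega> in M. word (length w) \<omega> = w) = word_weight q \<theta> w"
  using assms
proof (induction w rule: rev_induct)
  case Nil
  then show ?case by (simp add: word_def word_weight_def prob_space)
next
  case (snoc c w)
  let ?n = "length w"
  let ?past = "\<lambda>\<omega>. \<forall>l\<in>{1..<Suc ?n}. X l \<omega> = w ! (l - 1)"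
  have c: "c = 0 \<or> c = 1" using snoc.prems by auto
  have IH: "\<P>(\<omega> in M. ?past \<omega>) = word_weight q \<theta> w"
    using snoc by (simp add: word_eq_iff)
  have split: "\<P>(\<omega> in M. word (length (w @ [c])) \<omega> = w @ [c])
      = \<P>(\<omega> in M. X (Suc ?n) \<omega> = c \<and> ?past \<omega>)"
    by (intro arg_cong[where f = prob]) (auto simp: word_Suc word_eq_iff)
  show ?case
  proof (cases "\<P>(\<omega> in M. ?past \<omega>) > 0")
    case True
    have "\<P>(\<omega> in M. X (Suc ?n) \<omega> = 0 \<bar> ?past \<omega>) = 1 - \<theta> * q ^ count_list w 0"
      using failure_prob[of "Suc ?n" "Suc (count_list w 0)" "\<lambda>l. w ! (l - 1)"]
        card_letter_positions[of w 0] True by simp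
    moreover have "\<P>(\<omega> in M. X (Suc ?n) \<omega> = 1 \<bar> ?past \<omega>) = \<theta> * q ^ count_list w 0"
      using success_prob[of "Suc ?n" "Suc (count_list w 0)" "\<lambda>l. w ! (l - 1)"]
        card_letter_positions[of w 0] True by simp
    ultimately have "word_weight q \<theta> (w @ [c])
        = \<P>(\<omega> in M. ?past \<omega>) * \<P>(\<omega> in M. X (Suc ?n) \<omega> = c \<bar> ?past \<omega>)"
      unfolding IH using c word_weight_snoc[of q \<theta> w] by auto
    also have "\<dots> = \<P>(\<omega> in M. X (Suc ?n) \<omega> = c \<and> ?past \<omega>)"
      using True by (simp add: cond_prob_def)
    finally show ?thesis using split by simp
  next
    case False
    then have past: "\<P>(\<omega> in M. ?past \<omega>) = 0"
      using measure_nonneg[of M "{\<omega> \<in> space M. ?past \<omega>}"] by linarith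
    have "{\<omega> \<in> space M. ?past \<omega>} \<in> events"
      using word_event[of ?n w] by (simp add: word_eq_iff)
    then have "\<P>(\<omega> in M. X (Suc ?n) \<omega> = c \<and> ?past \<omega>) \<le> \<P>(\<omega> in M. ?past \<omega>)"
      by (intro finite_measure_mono) auto
    with past have "\<P>(\<omega> in M. X (Suc ?n) \<omega> = c \<and> ?past \<omega>) = 0"
      using measure_nonneg[of M "{\<omega> \<in> space M. X (Suc ?n) \<omega> = c \<and> ?past \<omega>}"] by linarith
    moreover have "word_weight q \<theta> (w @ [c]) = 0"
      using c IH past word_weight_snoc[of q \<theta> w] by auto
    ultimately show ?thesis using split by simp
  qed
qed

lemma prob_word_in:
  "\<P>(\<omega> in M. P (word n \<omega>)) = (\<Sum>w | set w \<subseteq> {0, 1} \<and> length w = n \<and> P w. word_weight q \<theta> w)"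
proof -
  let ?A = "{w. set w \<subseteq> {0, 1} \<and> length w = n \<and> P w}"
  have fin: "finite ?A"
    by (rule finite_subset[OF _ finite_lists_length_eq[of "{0, 1}" n]]) auto
  have "\<P>(\<omega> in M. P (word n \<omega>)) = prob (\<Union>w\<in>?A. {\<omega> \<in> space M. word n \<omega> = w})"
    using set_word by (intro arg_cong[where f = prob]) auto
  also have "\<dots> = (\<Sum>w\<in>?A. \<P>(\<omega> in M. word n \<omega> = w))"
    by (rule finite_measure_finite_Union[OF fin])
      (auto simp: word_event disjoint_family_on_def)
  also have "\<dots> = (\<Sum>w\<in>?A. word_weight q \<theta> w)"
    by (intro sum.cong) (use prob_word in auto)
  finally show ?thesis .
qed

end

section \<open>Summation over block lengths\<close>

text \<open>For \<open>k = 1\<close> the definition drops the condition on the maximum, but the equivalence persists: a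
  list of positive numbers with positive sum has an entry that is at least 1.\<close>

lemma comps_iff:
  assumes "0 < k"  "0 < r"
  shows "xs \<in> comps (k - 1) r s \<longleftrightarrow>
    length xs = s \<and> 0 \<notin> set xs \<and> sum_list xs = r \<and> (\<exists>x\<in>set xs. k \<le> x)"
proof -
  have "k - 1 = 0 \<or> xs \<noteq> [] \<and> Max (set xs) > k - 1 \<longleftrightarrow> (\<exists>x\<in>set xs. k \<le> x)"
    if "0 \<notin> set xs" "sum_list xs = r"
  proof -
    from that assms have "xs \<noteq> []" by auto
    moreover from this have "\<exists>x\<in>set xs. 1 \<le> x"
      using that(1) by (cases xs) auto
    ultimately show ?thesis
      using assms(1) by (cases k) (auto simp: Max_gr_iff Suc_le_eq)
  qed
  moreover have "(\<forall>x\<in>set xs. 0 < x) \<longleftrightarrow> 0 \<notin> set xs"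
    by (auto intro: gr0I)
  ultimately show ?thesis unfolding comps_def by blast
qed

lemma length_le_sum_list: "0 \<notin> set xs \<Longrightarrow> length xs \<le> sum_list (xs :: nat list)"
  by (induction xs) auto

definition block_pairs :: "nat \<Rightarrow> nat \<Rightarrow> nat \<Rightarrow> nat \<Rightarrow> (nat list \<times> nat list) set" where
  "block_pairs k l m r = {(xs, ys). balanced xs ys \<and> sum_list xs = m \<and> sum_list ys = r \<and>
     (\<exists>x\<in>set xs. k \<le> x) \<and> (\<exists>y\<in>set ys. l \<le> y)}"

definition words_with_runs :: "'b \<Rightarrow> 'b \<Rightarrow> nat \<Rightarrow> nat \<Rightarrow> nat \<Rightarrow> nat \<Rightarrow> 'b list set" where
  "words_with_runs a b k l m r = {w. set w \<subseteq> {a, b} \<and> count_list w a = m \<and> count_list w b = r \<and>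
     sublist (replicate k a) w \<and> sublist (replicate l b) w}"

text \<open>Exchanging the letters lets \<open>bij_betw_weave\<close> describe also the words that start with \<open>b\<close>.\<close>

lemma words_with_runs_commute: "words_with_runs a b k l m r = words_with_runs b a l k r m"
  by (auto simp: words_with_runs_def)

lemma bij_betw_weave:
  assumes "a \<noteq> b" "0 < k" "0 < l"
  shows "bij_betw (\<lambda>(xs, ys). weave a b xs ys) (block_pairs k l m r)
    {w \<in> words_with_runs a b k l m r. hd w = a}"
  unfolding bij_betw_def
proof
  show "inj_on (\<lambda>(xs, ys). weave a b xs ys) (block_pairs k l m r)"
    using weave_inject[OF assms(1)] by (fastforce simp: inj_on_def block_pairs_def)
  show "(\<lambda>(xs, ys). weave a b xs ys) ` block_pairs k l m r
      = {w \<in> words_with_runs a b k l m r. hd w = a}"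
  proof (intro equalityI subsetI)
    fix w assume "w \<in> (\<lambda>(xs, ys). weave a b xs ys) ` block_pairs k l m r"
    then obtain xs ys where w: "w = weave a b xs ys" and p: "(xs, ys) \<in> block_pairs k l m r"
      by auto
    then have "balanced xs ys" "xs \<noteq> []" by (auto simp: block_pairs_def)
    then show "w \<in> {w \<in> words_with_runs a b k l m r. hd w = a}"
      using p set_weave[of a b xs ys] assms
      by (simp add: w words_with_runs_def block_pairs_def run_weave count_weave hd_weave)
  next
    fix w assume w: "w \<in> {w \<in> words_with_runs a b k l m r. hd w = a}"
    then have "set w \<subseteq> {a, b}" "w \<noteq> []" "hd w = a"
      using assms by (auto simp: words_with_runs_def)
    then obtain xs ys where bal: "balanced xs ys" and "w = weave a b xs ys"
      using weave_surj[of w a b] weave_not_hd[OF _ assms(1)] by metis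
    with w show "w \<in> (\<lambda>(xs, ys). weave a b xs ys) ` block_pairs k l m r"
      using assms by (intro image_eqI[of _ _ "(xs, ys)"])
        (auto simp: words_with_runs_def block_pairs_def run_weave count_weave)
  qed
qed

text \<open>Balanced pairs are classified by the numbers of blocks of the two letters. The two versions take
  the summation index \<open>s\<close> to be the number of blocks of the second and of the first letter respectively, since the
  failures, whose blocks \<open>s\<close> counts in the theorem, can play either part. The range of \<open>s\<close>
  is enough because each block has at least one letter.\<close>

lemma sum_block_pairs:
  fixes f :: "nat list \<Rightarrow> nat list \<Rightarrow> real"
  assumes "0 < k" "0 < l" "0 < m" "0 < r"
  shows "(\<Sum>(xs, ys)\<in>block_pairs k l m r. f xs ys) =
    (\<Sum>s=1..r. (\<Sum>xs\<in>comps (k - 1) m s. \<Sum>ys\<in>comps (l - 1) r s. f xs ys)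
            + (\<Sum>xs\<in>comps (k - 1) m (s + 1). \<Sum>ys\<in>comps (l - 1) r s. f xs ys))"
    (is ?by_right)
  and "(\<Sum>(xs, ys)\<in>block_pairs k l m r. f xs ys) =
    (\<Sum>s=1..m. (\<Sum>xs\<in>comps (k - 1) m s. \<Sum>ys\<in>comps (l - 1) r s. f xs ys)
            + (\<Sum>xs\<in>comps (k - 1) m s. \<Sum>ys\<in>comps (l - 1) r (s - 1). f xs ys))"
    (is ?by_left)
proof -
  note comps = comps_iff[OF assms(1,3)] comps_iff[OF assms(2,4)]
  define C where "C s t = comps (k - 1) m s \<times> comps (l - 1) r t" for s t
  have fin: "finite (C s t)" for s t by (simp add: C_def finite_comps)
  have C: "(\<Sum>xs\<in>comps (k - 1) m s. \<Sum>ys\<in>comps (l - 1) r t. f xs ys) = (\<Sum>(xs, ys)\<in>C s t. f xs ys)"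
    for s t by (simp add: C_def sum.cartesian_product)
  define p where "p xs ys \<longleftrightarrow> 0 \<notin> set xs \<and> 0 \<notin> set ys \<and> sum_list xs = m \<and> sum_list ys = r \<and>
     (\<exists>x\<in>set xs. k \<le> x) \<and> (\<exists>y\<in>set ys. l \<le> y)" for xs ys
  have C_iff: "z \<in> C s t \<longleftrightarrow> length (fst z) = s \<and> length (snd z) = t \<and> p (fst z) (snd z)" for z s t
    unfolding C_def mem_Times_iff comps p_def by blast
  have pairs: "z \<in> block_pairs k l m r \<longleftrightarrow> p (fst z) (snd z) \<and>
      (length (fst z) = length (snd z) \<or> length (fst z) = Suc (length (snd z)))" for z
    by (cases z) (auto simp: block_pairs_def balanced_def p_def)
  have len: "1 \<le> length xs \<and> length xs \<le> m \<and> 1 \<le> length ys \<and> length ys \<le> r" if "p xs ys" for xs ys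
    using that length_le_sum_list[of xs] length_le_sum_list[of ys]
    by (cases xs; cases ys) (auto simp: p_def)
  have right: "block_pairs k l m r = (\<Union>s\<in>{1..r}. C s s \<union> C (s + 1) s)"
    by (rule set_eqI) (use len in \<open>auto simp: C_iff pairs\<close>)
  have left: "block_pairs k l m r = (\<Union>s\<in>{1..m}. C s s \<union> C s (s - 1))"
    by (rule set_eqI) (use len in \<open>fastforce simp: C_iff pairs\<close>)
  show ?by_right
    unfolding right C
    by (subst sum.UNION_disjoint) (auto simp: fin C_iff intro!: sum.cong sum.union_disjoint)
  show ?by_left
    unfolding left C
    by (subst sum.UNION_disjoint) (auto simp: fin C_iff intro!: sum.cong sum.union_disjoint)
qed

text \<open>Words starting with 1 have \<open>s\<close> or \<open>s + 1\<close> blocks of successes for \<open>s\<close> blocks of failures, which gives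
  \<open>T\<close> and \<open>S\<close>; words starting with 0 have \<open>s\<close> or \<open>s - 1\<close>, which gives \<open>Q\<close> and \<open>R\<close>.\<close>

lemma sum_words_with_runs:
  fixes q :: real
  assumes "0 < k1" "0 < k2" "0 < m" "0 < r"
  shows "(\<Sum>w\<in>words_with_runs 1 0 k1 k2 m r. q ^ noninversions w) =
    (\<Sum>s=1..r. Q_sum q k1 k2 m r s + R_sum q k1 k2 m r s
            + S_sum q k1 k2 m r (s + 1) + T_sum q k1 k2 m r s)"
proof -
  let ?W = "words_with_runs (1::nat) 0 k1 k2 m r"
  let ?e1 = "\<lambda>xs ys. \<Sum>j=2..length xs. sum_list (take (j - 1) ys) * xs ! (j - 1)"
  let ?e0 = "\<lambda>ys xs. \<Sum>j=1..length xs. sum_list (take j ys) * xs ! (j - 1)"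
  have fin: "finite ?W"
    by (rule finite_subset[OF _ finite_lists_length_eq[of "{0, 1}" "m + r"]])
      (auto simp: words_with_runs_def dest: count_binary)
  \<comment> \<open>No failure precedes the first block of successes, so the summand for \<open>j = 1\<close> vanishes.\<close>
  have noninversions_from_1: "noninversions (weave 1 0 xs ys) = ?e1 xs ys" if "balanced xs ys" for xs ys
  proof (cases "length xs = 0")
    case False
    then have "{1..length xs} = insert 1 {2..length xs}" by (auto simp: Suc_le_eq)
    then show ?thesis unfolding noninversions_weave(1)[OF that] by simp
  qed (use that in auto)
  have bij1: "bij_betw (\<lambda>(xs, ys). weave 1 0 xs ys) (block_pairs k1 k2 m r) {w \<in> ?W. hd w = 1}"
    using assms by (intro bij_betw_weave) auto
  have bij0: "bij_betw (\<lambda>(ys, xs). weave 0 1 ys xs) (block_pairs k2 k1 r m) {w \<in> ?W. hd w = 0}"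
    unfolding words_with_runs_commute[of "1::nat" 0 k1 k2 m r]
    using assms by (intro bij_betw_weave) auto
  have hd_W: "hd w = 1 \<or> hd w = 0" if "w \<in> ?W" for w
  proof -
    from that assms have "w \<noteq> []" "set w \<subseteq> {0, 1}" by (auto simp: words_with_runs_def)
    then have "hd w \<in> {0, 1}" by (meson hd_in_set subsetD)
    then show ?thesis by auto
  qed
  have "(\<Sum>w\<in>?W. q ^ noninversions w)
      = (\<Sum>w\<in>{w \<in> ?W. hd w = 1} \<union> {w \<in> ?W. hd w = 0}. q ^ noninversions w)"
    by (rule sum.cong) (auto dest: hd_W simp del: One_nat_def)
  also have "\<dots> = (\<Sum>w\<in>{w \<in> ?W. hd w = 1}. q ^ noninversions w)
      + (\<Sum>w\<in>{w \<in> ?W. hd w = 0}. q ^ noninversions w)"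
    by (rule sum.union_disjoint) (use fin in auto)
  also have "(\<Sum>w\<in>{w \<in> ?W. hd w = 1}. q ^ noninversions w)
      = (\<Sum>(xs, ys)\<in>block_pairs k1 k2 m r. q ^ ?e1 xs ys)"
    unfolding sum.reindex_bij_betw[OF bij1, symmetric]
    by (intro sum.cong) (auto simp: block_pairs_def noninversions_from_1 simp del: One_nat_def)
  also have "\<dots> = (\<Sum>s=1..r. T_sum q k1 k2 m r s + S_sum q k1 k2 m r (s + 1))"
    unfolding sum_block_pairs(1)[OF assms] S_sum_def T_sum_def
    by (intro sum.cong arg_cong2[where f = "(+)"]) (auto simp: comps_def)
  also have "(\<Sum>w\<in>{w \<in> ?W. hd w = 0}. q ^ noninversions w)
      = (\<Sum>(ys, xs)\<in>block_pairs k2 k1 r m. q ^ ?e0 ys xs)"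
    unfolding sum.reindex_bij_betw[OF bij0, symmetric]
    by (intro sum.cong) (auto simp: block_pairs_def noninversions_weave simp del: One_nat_def)
  also have "\<dots> = (\<Sum>s=1..r. Q_sum q k1 k2 m r s + R_sum q k1 k2 m r s)"
  proof -
    have "(\<Sum>ys\<in>comps (k2 - 1) r s. \<Sum>xs\<in>comps (k1 - 1) m s. q ^ ?e0 ys xs)
        = Q_sum q k1 k2 m r s" for s
      unfolding Q_sum_def by (subst sum.swap, intro sum.cong) (auto simp: comps_def)
    moreover have "(\<Sum>ys\<in>comps (k2 - 1) r s. \<Sum>xs\<in>comps (k1 - 1) m (s - 1). q ^ ?e0 ys xs)
        = R_sum q k1 k2 m r s" for s
      unfolding R_sum_def by (subst sum.swap, intro sum.cong) (auto simp: comps_def)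
    ultimately show ?thesis
      unfolding sum_block_pairs(2)[OF assms(2,1,4,3)] by simp
  qed
  finally show ?thesis
    by (simp add: sum.distrib)
qed

theorem theorem7p4:
  fixes M :: "'a measure" and X :: "nat \<Rightarrow> 'a \<Rightarrow> nat" and q \<theta> :: real and k1 k2 n :: nat
  assumes "0 \<le> \<theta>" and "\<theta> \<le> 1" and "0 < q" and "q < 1"
    and "q_bernoulli_process M X q \<theta>"
    and "k1 \<ge> 1" and "k2 \<ge> 1" and "n \<ge> k1 + k2"
  shows "\<P>(\<omega> in M. longest_success_run X n \<omega> \<ge> k1 \<and> longest_failure_run X n \<omega> \<ge> k2) =
    (\<Sum>i=k2..n - k1. \<theta> ^ (n - i) * (\<Prod>j=1..i. 1 - \<theta> * q ^ (j - 1)) *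
       (\<Sum>s=1..i. Q_sum q k1 k2 (n - i) i s + R_sum q k1 k2 (n - i) i s
                  + S_sum q k1 k2 (n - i) i (s + 1) + T_sum q k1 k2 (n - i) i s))"
proof -
  interpret q_bernoulli_process M X q \<theta> by fact
  let ?P = "\<lambda>w. sublist (replicate k1 1) w \<and> sublist (replicate k2 (0::nat)) w"
  let ?A = "{w. set w \<subseteq> {0, 1} \<and> length w = n \<and> ?P w}"
  have le_count: "k \<le> count_list w c" if "sublist (replicate k c) w" for k c and w :: "nat list"
    using that by (auto simp: sublist_def count_list_replicate)
  have length_A: "count_list w 1 + count_list w 0 = n" if "w \<in> ?A" for w
    using that count_binary[of w 1 0] by auto
  have "finite ?A"
    by (rule finite_subset[OF _ finite_lists_length_eq[of "{0, 1}" n]]) auto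
  \<comment> \<open>The two runs take up at least \<open>k1\<close> successes and \<open>k2\<close> failures, which bounds \<open>i\<close>.\<close>
  have count_A: "(\<lambda>w. count_list w 0) ` ?A \<subseteq> {k2..n - k1}"
  proof
    fix i assume "i \<in> (\<lambda>w. count_list w 0) ` ?A"
    then obtain w where "w \<in> ?A" "i = count_list w 0" by blast
    then show "i \<in> {k2..n - k1}"
      using length_A[of w] le_count[of k1 1 w] le_count[of k2 0 w] by auto
  qed
  have fibre: "{w \<in> ?A. count_list w 0 = i} = words_with_runs 1 0 k1 k2 (n - i) i"
    if "i \<in> {k2..n - k1}" for i
  proof -
    have "count_list w 1 = n - i \<longleftrightarrow> length w = n"
      if "set w \<subseteq> {0, 1}" "count_list w 0 = i" for w :: "nat list"
      using that \<open>i \<in> _\<close> count_binary[of w 0 1] assms by auto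
    then show ?thesis by (auto simp: words_with_runs_def insert_commute)
  qed
  have "\<P>(\<omega> in M. longest_success_run X n \<omega> \<ge> k1 \<and> longest_failure_run X n \<omega> \<ge> k2)
      = \<P>(\<omega> in M. ?P (word n \<omega>))"
    by (simp add: longest_success_run_def longest_failure_run_def le_longest_run_iff word_def)
  also have "\<dots> = (\<Sum>w\<in>?A. word_weight q \<theta> w)"
    by (rule prob_word_in)
  also have "\<dots> = (\<Sum>i=k2..n - k1. \<Sum>w | w \<in> ?A \<and> count_list w 0 = i. word_weight q \<theta> w)"
    by (rule sum.group[symmetric]) (use \<open>finite ?A\<close> count_A in auto)
  also have "\<dots> = (\<Sum>i=k2..n - k1. \<theta> ^ (n - i) * (\<Prod>j=1..i. 1 - \<theta> * q ^ (j - 1)) *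
       (\<Sum>s=1..i. Q_sum q k1 k2 (n - i) i s + R_sum q k1 k2 (n - i) i s
                  + S_sum q k1 k2 (n - i) i (s + 1) + T_sum q k1 k2 (n - i) i s))"
  proof (rule sum.cong[OF refl])
    fix i assume i: "i \<in> {k2..n - k1}"
    have "(\<Sum>w | w \<in> ?A \<and> count_list w 0 = i. word_weight q \<theta> w)
        = (\<Sum>w\<in>words_with_runs 1 0 k1 k2 (n - i) i.
             \<theta> ^ (n - i) * (\<Prod>j=1..i. 1 - \<theta> * q ^ (j - 1)) * q ^ noninversions w)"
      unfolding fibre[OF i] by (intro sum.cong) (auto simp: words_with_runs_def word_weight_def)
    also have "\<dots> = \<theta> ^ (n - i) * (\<Prod>j=1..i. 1 - \<theta> * q ^ (j - 1)) *
        (\<Sum>w\<in>words_with_runs 1 0 k1 k2 (n - i) i. q ^ noninversions w)"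
      by (simp add: sum_distrib_left)
    finally show "(\<Sum>w | w \<in> ?A \<and> count_list w 0 = i. word_weight q \<theta> w)
        = \<theta> ^ (n - i) * (\<Prod>j=1..i. 1 - \<theta> * q ^ (j - 1)) *
       (\<Sum>s=1..i. Q_sum q k1 k2 (n - i) i s + R_sum q k1 k2 (n - i) i s
                  + S_sum q k1 k2 (n - i) i (s + 1) + T_sum q k1 k2 (n - i) i s)"
      using i assms by (subst (asm) sum_words_with_runs) auto
  qed
  finally show ?thesis .
qed

end
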